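(* For every pair $(A,B) \in \{(36,30), (72,42), (196,70), (252,114)\}$ and every integer $n \geq 0$, we have $\nu_3(An+B) \equiv 0 \pmod{2}$.
   Context: For a positive integer $m$ and $k \geq 1$, $\nu_k(m)$ denotes the number of partitions of $m$ in which exactly $k$ distinct part sizes appear. *)

theory Defs
  imports "HOL-Library.Multiset" "HOL-Number_Theory.Cong"
begin

definition int_partitions :: "nat \<Rightarrow> nat multiset set" where
  "int_partitions m = {P. 0 \<notin># P \<and> sum_mset P = m}"

definition nu :: "nat \<Rightarrow> nat \<Rightarrow> nat" where
  "nu k m = card {P \<in> int_partitions m. card (set_mset P) = k}"

text \<open>There are only finitely many partitions, so the cardinality in \<^const>\<open>nu\<close> is a genuine count.\<close>

lemma finite_int_partitions: "finite (int_partitions m)"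
proof (rule finite_subset)
  show "int_partitions m \<subseteq> mset ` {xs. set xs \<subseteq> {..m} \<and> length xs \<le> m}"
  proof
    fix P assume "P \<in> int_partitions m"
    hence P: "0 \<notin># P" "sum_mset P = m" by (auto simp: int_partitions_def)
    have le: "x \<le> m" if "x \<in># P" for x
      using that P(2) by (metis le_add1 multi_member_split sum_mset.add_mset)
    have "0 \<notin># Q \<Longrightarrow> size Q \<le> sum_mset Q" for Q :: "nat multiset"
      by (induction Q) auto
    hence sz: "size P \<le> m" using P by blast
    obtain xs where "mset xs = P" using ex_mset by blast
    thus "P \<in> mset ` {xs. set xs \<subseteq> {..m} \<and> length xs \<le> m}"
      using le sz by (intro image_eqI[of _ _ xs]) auto
  qed
  show "finite (mset ` {xs. set xs \<subseteq> {..m} \<and> length xs \<le> m})"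
    by (intro finite_imageI finite_lists_length_le) simp
qed

end

theory Submission
  imports Defs "HOL-Number_Theory.Residues"
begin

text \<open>
  Write \<open>N = 2 * p * m\<close> with \<open>p\<close> a prime congruent to 3 modulo 4 and \<open>m\<close> odd, prime to \<open>p\<close> and not a
  square; the four progressions are of this form with \<open>p = 3\<close> or \<open>p = 7\<close>. Everything is counted
  modulo 2 by involutions.

  A partition of type \<open>\<nu>\<^sub>3\<close> with one of its three part sizes marked is a pair of blocks
  \<open>x\<^sup>a y\<^sup>b\<close> with \<open>x < y\<close> together with a block \<open>z\<^sup>c\<close>, \<open>z \<noteq> x, y\<close>. Dropping the last condition,
  transposing the block \<open>z\<^sup>c\<close> and conjugating the partition \<open>x\<^sup>a y\<^sup>b\<close> leaves the solutions of
  \<open>s\<^sup>2 + x (x + 2 d) = N\<close>. These are the fixed points of Zagier's involution on the solutions of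
  \<open>s\<^sup>2 + u\<^sup>2 + 4 y z = N\<close>, which is defined everywhere because \<open>N\<close> is not a sum of two squares;
  transposing \<open>y, z\<close> and \<open>s, u\<close> instead leaves the solutions of \<open>2 s\<^sup>2 + 4 y\<^sup>2 = N\<close>.
  The superfluous terms with \<open>z = x\<close> or \<open>z = y\<close> reduce to the solutions of \<open>2 x a + y b = N\<close> with
  \<open>x \<noteq> y\<close>. Without the condition \<open>x \<noteq> y\<close> this again gives \<open>2 s\<^sup>2 + t\<^sup>2 = N\<close>, and the two
  contributions cancel. What remains is \<open>x (2 a + b) = N\<close>, that is, the sum of \<open>(d - 1) div 2\<close> over
  the divisors \<open>d\<close> of \<open>N\<close>, which has the parity of the number of divisors of \<open>m\<close>.
\<close>

section \<open>Parity of finite sets by involutions\<close>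

lemma even_card_involution:
  assumes "finite A" "\<And>x. x \<in> A \<Longrightarrow> f x \<in> A" "\<And>x. x \<in> A \<Longrightarrow> f (f x) = x"
  shows "even (card A) \<longleftrightarrow> even (card {x \<in> A. f x = x})"
  using assms
proof (induction "card A" arbitrary: A rule: less_induct)
  case less
  show ?case
  proof (cases "\<exists>x\<in>A. f x \<noteq> x")
    case True
    then obtain x where x: "x \<in> A" "f x \<noteq> x" by blast
    \<comment> \<open>Removing a two-element orbit lowers the cardinality by 2 and keeps all fixed
      points.\<close>
    let ?B = "A - {x, f x}"
    have sub: "{x, f x} \<subseteq> A" using x less.prems by auto
    have card2: "card {x, f x} = 2" using x(2) by auto
    have cA: "card A = card ?B + 2"
      using card_Diff_subset[OF _ sub] card_mono[OF less.prems(1) sub] card2 by simp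
    have fix_eq: "{y \<in> ?B. f y = y} = {y \<in> A. f y = y}"
      using x less.prems(3) by auto
    have closed: "f y \<in> ?B" if "y \<in> ?B" for y
      using that less.prems(2,3) x(1) by (metis Diff_iff insert_iff singletonD)
    have "even (card ?B) \<longleftrightarrow> even (card {y \<in> ?B. f y = y})"
      using closed less.prems cA by (intro less.hyps) auto
    then show ?thesis using cA fix_eq by simp
  next
    case False
    then have "{x \<in> A. f x = x} = A" by auto
    then show ?thesis by simp
  qed
qed

text \<open>\<open>g\<close> and \<open>h\<close> are mutually inverse between \<open>B\<close> and
  the fixed points of \<open>f\<close>, so a reduction only has to exhibit three explicit
  maps.\<close>

lemma even_card_involution_bij:
  assumes fin: "finite A"
    and f: "\<And>p. p \<in> A \<Longrightarrow> f p \<in> A \<and> f (f p) = p"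
    and g: "\<And>q. q \<in> B \<Longrightarrow> g q \<in> A \<and> f (g q) = g q \<and> h (g q) = q"
    and h: "\<And>p. p \<in> A \<Longrightarrow> f p = p \<Longrightarrow> h p \<in> B \<and> g (h p) = p"
  shows "even (card A) \<longleftrightarrow> even (card B)"
proof -
  have "bij_betw g B {p \<in> A. f p = p}"
    using g h by (intro bij_betw_byWitness[where f' = h]) auto
  with even_card_involution[OF fin, of f] f show ?thesis
    by (simp add: bij_betw_same_card)
qed

lemma factor_le_of_add_eq:
  fixes x y k N :: nat
  assumes "x * y + k = N" "0 < x" "0 < y"
  shows "x \<le> N" "y \<le> N"
proof -
  have "x \<le> x * y" "y \<le> x * y" using assms(2,3) by simp_all
  then show "x \<le> N" "y \<le> N" using assms(1) by linarith+
qed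

section \<open>Partitions with three part sizes, one of them marked\<close>

text \<open>Each part size \<open>x\<close>, \<open>y\<close>, \<open>z\<close> is followed by its
  multiplicity. The sizes need be neither ordered nor distinct.\<close>

definition weighted_triples :: "nat \<Rightarrow> (nat \<times> nat \<times> nat \<times> nat \<times> nat \<times> nat) set" where
  "weighted_triples N = {(x, a, y, b, z, c). 0 < x \<and> 0 < a \<and> 0 < y \<and> 0 < b \<and> 0 < z \<and> 0 < c \<and>
     x * a + y * b + z * c = N}"

lemma finite_weighted_triples: "finite (weighted_triples N)"
proof (rule finite_subset)
  show "weighted_triples N \<subseteq> {..N} \<times> {..N} \<times> {..N} \<times> {..N} \<times> {..N} \<times> {..N}"
  proof (clarsimp simp: weighted_triples_def, intro conjI)
    fix x a y b z c :: nat
    assume pos: "0 < x" "0 < a" "0 < y" "0 < b" "0 < z" "0 < c"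
    let ?N = "x * a + y * b + z * c"
    show "x \<le> ?N" "a \<le> ?N" using factor_le_of_add_eq[of x a "y * b + z * c" ?N] pos by auto
    show "y \<le> ?N" "b \<le> ?N" using factor_le_of_add_eq[of y b "x * a + z * c" ?N] pos by auto
    show "z \<le> ?N" "c \<le> ?N" using factor_le_of_add_eq[of z c "x * a + y * b" ?N] pos by auto
  qed
qed simp

lemma nu_3_eq_card:
  "nu 3 N = card {(x, a, y, b, z, c) \<in> weighted_triples N. x < y \<and> y < z}"
proof -
  let ?A = "{(x, a, y, b, z, c) \<in> weighted_triples N. x < y \<and> y < z}"
  let ?F = "\<lambda>(x, a, y, b, z, c). replicate_mset a x + replicate_mset b y + replicate_mset c (z::nat)"
  let ?P = "{P \<in> int_partitions N. card (set_mset P) = 3}"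
  have "bij_betw ?F ?A ?P"
  proof (rule bij_betw_imageI)
    show "inj_on ?F ?A"
    proof (rule inj_onI, clarsimp simp: weighted_triples_def)
      fix x a y b z c x' a' y' b' z' c' :: nat
      assume pos: "0 < a" "0 < b" "0 < c" "0 < a'" "0 < b'" "0 < c'"
        and ord: "x < y" "y < z" "x' < y'" "y' < z'"
        and eq: "replicate_mset a x + replicate_mset b y + replicate_mset c z =
                 replicate_mset a' x' + replicate_mset b' y' + replicate_mset c' z'"
      have "{x, y, z} = {x', y', z'}"
        using arg_cong[OF eq, of set_mset] pos by (simp add: insert_commute)
      then have xyz: "x = x' \<and> y = y' \<and> z = z'"
        using ord sorted_distinct_set_unique[of "[x, y, z]" "[x', y', z']"] by simp
      then show "x = x' \<and> a = a' \<and> y = y' \<and> b = b' \<and> z = z' \<and> c = c'"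
        using ord arg_cong[OF eq, of "\<lambda>M. count M x"] arg_cong[OF eq, of "\<lambda>M. count M y"]
          arg_cong[OF eq, of "\<lambda>M. count M z"] by (auto split: if_splits)
    qed
    show "?F ` ?A = ?P"
    proof (intro equalityI subsetI)
      fix P assume "P \<in> ?F ` ?A"
      then show "P \<in> ?P"
        by (auto simp: weighted_triples_def int_partitions_def mult.commute)
    next
      fix P assume "P \<in> ?P"
      then have P: "0 \<notin># P" "sum_mset P = N" "card (set_mset P) = 3"
        by (auto simp: int_partitions_def)
      define xs where "xs = sorted_list_of_set (set_mset P)"
      have len: "length xs = 3" and set_xs: "set xs = set_mset P" and so: "sorted_wrt (<) xs"
        using P(3) by (auto simp: xs_def)
      obtain x y z where xs: "xs = [x, y, z]"
        using len by (auto simp: numeral_3_eq_3 length_Suc_conv)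
      have ord: "x < y" "y < z" using so xs by auto
      have mem: "set_mset P = {x, y, z}" using set_xs xs by auto
      have eq: "P = replicate_mset (count P x) x + replicate_mset (count P y) y
                    + replicate_mset (count P z) z"
      proof (rule multiset_eqI)
        fix w
        show "count P w = count (replicate_mset (count P x) x + replicate_mset (count P y) y
                    + replicate_mset (count P z) z) w"
        proof (cases "w \<in> {x, y, z}")
          case True
          then show ?thesis using ord by auto
        next
          case False
          then have "count P w = 0" using mem by (simp add: count_eq_zero_iff)
          then show ?thesis using False by simp
        qed
      qed
      have "sum_mset P = x * count P x + y * count P y + z * count P z"
        using arg_cong[OF eq, of sum_mset] by (simp add: mult.commute)
      moreover have "0 < x" "0 < y" "0 < z" using P(1) mem by (auto intro: gr0I)
      moreover have "0 < count P x" "0 < count P y" "0 < count P z" using mem by auto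
      ultimately have "(x, count P x, y, count P y, z, count P z) \<in> ?A"
        using ord P(2) by (simp add: weighted_triples_def)
      moreover have "P = ?F (x, count P x, y, count P y, z, count P z)"
        unfolding prod.case by (rule eq)
      ultimately show "P \<in> ?F ` ?A" by (rule image_eqI[rotated])
    qed
  qed
  then have "card ?A = card ?P" by (rule bij_betw_same_card)
  then show ?thesis unfolding nu_def by (rule sym)
qed

text \<open>\<open>z\<close> is the marked size. Allowing it to equal \<open>x\<close> or
  \<open>y\<close> makes the set stable under transposing \<open>z\<close> and
  \<open>c\<close>.\<close>

definition marked_pairs :: "nat \<Rightarrow> (nat \<times> nat \<times> nat \<times> nat \<times> nat \<times> nat) set" where
  "marked_pairs N = {(x, a, y, b, z, c) \<in> weighted_triples N. x < y}"

lemma finite_marked_pairs: "finite (marked_pairs N)"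
  unfolding marked_pairs_def by (rule finite_subset[OF _ finite_weighted_triples]) auto

text \<open>The marked size may lie below, between or above the other two, and each position gives
  one copy of the partitions. The odd factor 3 keeps the parity of \<open>nu 3 N\<close>.\<close>

lemma card_marked_pairs:
  "card (marked_pairs N) = 3 * nu 3 N
     + card {(x, a, y, b, z, c) \<in> marked_pairs N. z = x}
     + card {(x, a, y, b, z, c) \<in> marked_pairs N. z = y}"
proof -
  let ?T = "marked_pairs N"
  let ?S = "{(x, a, y, b, z, c) \<in> weighted_triples N. x < y \<and> y < z}"
  let ?T1 = "{(x, a, y, b, z, c) \<in> ?T. z < x}"
  let ?T2 = "{(x, a, y, b, z, c) \<in> ?T. x < z \<and> z < y}"
  let ?T3 = "{(x, a, y, b, z, c) \<in> ?T. y < z}"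
  let ?Tx = "{(x, a, y, b, z, c) \<in> ?T. z = x}"
  let ?Ty = "{(x, a, y, b, z, c) \<in> ?T. z = y}"
  have c1: "card ?T1 = card ?S"
    by (rule bij_betw_same_card, rule bij_betw_byWitness[where
          f = "\<lambda>(x, a, y, b, z, c). (z, c, x, a, y, b)" and f' = "\<lambda>(z, c, x, a, y, b). (x, a, y, b, z, c)"])
      (auto simp: marked_pairs_def weighted_triples_def)
  have c2: "card ?T2 = card ?S"
    by (rule bij_betw_same_card, rule bij_betw_byWitness[where
          f = "\<lambda>(x, a, y, b, z, c). (x, a, z, c, y, b)" and f' = "\<lambda>(x, a, z, c, y, b). (x, a, y, b, z, c)"])
      (auto simp: marked_pairs_def weighted_triples_def)
  have c3: "?T3 = ?S" by (auto simp: marked_pairs_def)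
  have fin: "finite X" if "X \<subseteq> ?T" for X using that finite_marked_pairs by (rule finite_subset)
  have sub: "?T1 \<subseteq> ?T" "?T2 \<subseteq> ?T" "?T3 \<subseteq> ?T" "?Tx \<subseteq> ?T" "?Ty \<subseteq> ?T" by auto
  have eq: "?T = ?T1 \<union> (?T2 \<union> (?T3 \<union> (?Tx \<union> ?Ty)))" by auto
  have "card ?T = card (?T1 \<union> (?T2 \<union> (?T3 \<union> (?Tx \<union> ?Ty))))" by (rule arg_cong[OF eq])
  moreover have "card (?T1 \<union> (?T2 \<union> (?T3 \<union> (?Tx \<union> ?Ty)))) = card ?T1 + card (?T2 \<union> (?T3 \<union> (?Tx \<union> ?Ty)))"
    by (intro card_Un_disjoint fin Un_least sub) (auto simp: marked_pairs_def)
  moreover have "card (?T2 \<union> (?T3 \<union> (?Tx \<union> ?Ty))) = card ?T2 + card (?T3 \<union> (?Tx \<union> ?Ty))"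
    by (intro card_Un_disjoint fin Un_least sub) auto
  moreover have "card (?T3 \<union> (?Tx \<union> ?Ty)) = card ?T3 + card (?Tx \<union> ?Ty)"
    by (intro card_Un_disjoint fin Un_least sub) (auto simp: marked_pairs_def)
  moreover have "card (?Tx \<union> ?Ty) = card ?Tx + card ?Ty"
    by (intro card_Un_disjoint fin Un_least sub) (auto simp: marked_pairs_def)
  ultimately show ?thesis unfolding c1 c2 c3 nu_3_eq_card by linarith
qed

definition doubled_pairs :: "nat \<Rightarrow> (nat \<times> nat \<times> nat \<times> nat) set" where
  "doubled_pairs N = {(x, a, y, b). 0 < x \<and> 0 < a \<and> 0 < y \<and> 0 < b \<and> 2 * (x * a) + y * b = N}"

lemma finite_doubled_pairs: "finite (doubled_pairs N)"
proof (rule finite_subset)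
  show "doubled_pairs N \<subseteq> {..N} \<times> {..N} \<times> {..N} \<times> {..N}"
  proof (clarsimp simp: doubled_pairs_def, intro conjI)
    fix x a y b :: nat
    assume pos: "0 < x" "0 < a" "0 < y" "0 < b"
    let ?N = "2 * (x * a) + y * b"
    show "x \<le> ?N" "a \<le> ?N" using factor_le_of_add_eq[of x a "x * a + y * b" ?N] pos by auto
    show "y \<le> ?N" "b \<le> ?N" using factor_le_of_add_eq[of y b "2 * (x * a)" ?N] pos by auto
  qed
qed simp

text \<open>When \<open>z = x\<close>, both \<open>a\<close> and \<open>c\<close> are multiplicities
  of the same size and can be exchanged. A fixed point has \<open>a = c\<close>, so this size
  contributes \<open>2 * (x * a)\<close>.\<close>

lemma even_card_marked_pairs_first:
  "even (card {(x, a, y, b, z, c) \<in> marked_pairs N. z = x}) \<longleftrightarrow>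
   even (card {(x, a, y, b) \<in> doubled_pairs N. x < y})"
proof (rule even_card_involution_bij[where f = "\<lambda>(x, a, y, b, z, c). (x, c, y, b, z, a)"
      and g = "\<lambda>(x, a, y, b). (x, a, y, b, x, a)" and h = "\<lambda>(x, a, y, b, z, c). (x, a, y, b)"])
  show "finite {(x, a, y, b, z, c) \<in> marked_pairs N. z = x}"
    by (rule finite_subset[OF _ finite_marked_pairs]) auto
qed (clarsimp simp: marked_pairs_def weighted_triples_def doubled_pairs_def)+

text \<open>Here \<open>b\<close> and \<open>c\<close> are exchanged. The doubled block comes first
  in \<open>doubled_pairs\<close>, so the larger size moves to the front and the inequality
  reverses.\<close>

lemma even_card_marked_pairs_second:
  "even (card {(x, a, y, b, z, c) \<in> marked_pairs N. z = y}) \<longleftrightarrow>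
   even (card {(x, a, y, b) \<in> doubled_pairs N. y < x})"
proof (rule even_card_involution_bij[where f = "\<lambda>(x, a, y, b, z, c). (x, a, y, c, z, b)"
      and g = "\<lambda>(y, b, x, a). (x, a, y, b, y, b)" and h = "\<lambda>(x, a, y, b, z, c). (y, b, x, a)"])
  show "finite {(x, a, y, b, z, c) \<in> marked_pairs N. z = y}"
    by (rule finite_subset[OF _ finite_marked_pairs]) auto
qed (clarsimp simp: marked_pairs_def weighted_triples_def doubled_pairs_def)+

lemma card_doubled_pairs:
  "card (doubled_pairs N) = card {(x, a, y, b) \<in> doubled_pairs N. x < y}
     + card {(x, a, y, b) \<in> doubled_pairs N. y < x} + card {(x, a, y, b) \<in> doubled_pairs N. x = y}"
proof -
  let ?W = "doubled_pairs N"
  let ?L = "{(x, a, y, b) \<in> ?W. x < y}" and ?G = "{(x, a, y, b) \<in> ?W. y < x}"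
    and ?E = "{(x, a, y, b) \<in> ?W. x = y}"
  have fin: "finite X" if "X \<subseteq> ?W" for X using that finite_doubled_pairs by (rule finite_subset)
  have sub: "?L \<subseteq> ?W" "?G \<subseteq> ?W" "?E \<subseteq> ?W" by auto
  have eq: "?W = (?L \<union> ?G) \<union> ?E" by auto
  have "card ?W = card ((?L \<union> ?G) \<union> ?E)" by (rule arg_cong[OF eq])
  moreover have "card ((?L \<union> ?G) \<union> ?E) = card (?L \<union> ?G) + card ?E"
    by (intro card_Un_disjoint fin Un_least sub) auto
  moreover have "card (?L \<union> ?G) = card ?L + card ?G"
    by (intro card_Un_disjoint fin Un_least sub) auto
  ultimately show ?thesis by linarith
qed

lemma even_card_doubled_pairs:
  "even (card (doubled_pairs N)) \<longleftrightarrow>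
   even (card {(s, t). 0 < s \<and> 0 < t \<and> 2 * (s * s) + t * t = N})"
proof -
  let ?f = "\<lambda>(x, a, y, b). (a, x, y, b)" and ?g = "\<lambda>(x, a, y, b). (x, a, b, y)"
  let ?V = "{p \<in> doubled_pairs N. ?f p = p}"
  have "even (card (doubled_pairs N)) \<longleftrightarrow> even (card ?V)"
    by (rule even_card_involution[OF finite_doubled_pairs]) (clarsimp simp: doubled_pairs_def)+
  also have "\<dots> \<longleftrightarrow> even (card {(s, t). 0 < s \<and> 0 < t \<and> 2 * (s * s) + t * t = N})"
  proof (rule even_card_involution_bij[where f = ?g and g = "\<lambda>(s, t). (s, s, t, t)"
        and h = "\<lambda>(x, a, y, b). (x, y)"])
    show "finite ?V" by (rule finite_subset[OF _ finite_doubled_pairs]) auto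
  qed (clarsimp simp: doubled_pairs_def)+
  finally show ?thesis .
qed

text \<open>Transposing \<open>z\<close> and \<open>c\<close> leaves \<open>z = c\<close>. A
  self-conjugate remainder has \<open>b = x\<close> and \<open>y = x + a\<close>, hence the sum
  \<open>x * a + (x + a) * x = x * (x + 2 * a)\<close>.\<close>

lemma even_card_marked_pairs_conjugation:
  "even (card (marked_pairs N)) \<longleftrightarrow>
   even (card {(s, x, d). 0 < s \<and> 0 < x \<and> 0 < d \<and> s * s + x * (x + 2 * d) = N})"
proof -
  let ?f = "\<lambda>(x, a, y, b, z, c). (x, a, y, b, c, z)"
  \<comment> \<open>conjugation of the partition with parts \<open>x\<close> (\<open>a\<close> times) and \<open>y\<close> (\<open>b\<close> times)\<close>
  let ?g = "\<lambda>(x, a, y, b, z, c). (b, y - x, a + b, x, z, c)"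
  let ?V = "{(x, a, y, b, z, c) \<in> marked_pairs N. c = z}"
  let ?X = "{(s, x, d). 0 < s \<and> 0 < x \<and> 0 < d \<and> s * s + x * (x + 2 * d) = N}"
  have "even (card (marked_pairs N)) \<longleftrightarrow> even (card ?V)"
    by (rule even_card_involution_bij[where f = ?f and g = id and h = id])
      (rule finite_marked_pairs, (clarsimp simp: marked_pairs_def weighted_triples_def)+)
  also have "\<dots> \<longleftrightarrow> even (card {(s, x, d). 0 < s \<and> 0 < x \<and> 0 < d \<and> s * s + x * (x + 2 * d) = N})"
  proof (rule even_card_involution_bij[where f = ?g and g = "\<lambda>(s, x, d). (x, d, x + d, x, s, s)"
        and h = "\<lambda>(x, a, y, b, z, c). (z, x, a)"])
    show "finite ?V" by (rule finite_subset[OF _ finite_marked_pairs]) auto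
    show "?g p \<in> ?V \<and> ?g (?g p) = p" if "p \<in> ?V" for p
    proof -
      obtain x a y b z c where p: "p = (x, a, y, b, z, c)" by (cases p)
      have pos: "0 < x" "0 < a" "0 < y" "0 < b" "0 < z" "x < y" "c = z"
        and eq: "x * a + y * b + z * z = N"
        using that unfolding p marked_pairs_def weighted_triples_def by auto
      obtain k where k: "y = x + k" "0 < k" using less_imp_add_positive[OF pos(6)] by metis
      have "b * k + (a + b) * x + z * z = N" using eq k by (simp add: algebra_simps)
      then show ?thesis using pos k p by (simp add: marked_pairs_def weighted_triples_def)
    qed
    show "(\<lambda>(s, x, d). (x, d, x + d, x, s, s)) q \<in> ?V \<and>
        ?g ((\<lambda>(s, x, d). (x, d, x + d, x, s, s)) q) = (\<lambda>(s, x, d). (x, d, x + d, x, s, s)) q \<and>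
        (\<lambda>(x, a, y, b, z, c). (z, x, a)) ((\<lambda>(s, x, d). (x, d, x + d, x, s, s)) q) = q"
      if "q \<in> ?X" for q
    proof -
      obtain s x d where q: "q = (s, x, d)" by (cases q)
      have pos: "0 < s" "0 < x" "0 < d" and eq: "s * s + x * (x + 2 * d) = N"
        using that unfolding q by simp_all
      have "x * d + (x + d) * x + s * s = N" using eq by (simp add: algebra_simps)
      then show ?thesis using pos q by (simp add: marked_pairs_def weighted_triples_def)
    qed
    show "(\<lambda>(x, a, y, b, z, c). (z, x, a)) p \<in> ?X \<and>
        (\<lambda>(s, x, d). (x, d, x + d, x, s, s)) ((\<lambda>(x, a, y, b, z, c). (z, x, a)) p) = p"
      if "p \<in> ?V" "?g p = p" for p
    proof -
      obtain x a y b z c where p: "p = (x, a, y, b, z, c)" by (cases p)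
      have b: "b = x" and y: "a + b = y" using that(2) unfolding p prod.case prod.inject by blast+
      have pos: "0 < x" "0 < a" "0 < z" "c = z" and eq: "x * a + y * b + z * z = N"
        using that(1) unfolding p marked_pairs_def weighted_triples_def by auto
      have "z * z + x * (x + 2 * a) = N" using eq unfolding y[symmetric] b by (simp add: algebra_simps)
      then show ?thesis using pos p b y by simp
    qed
  qed
  finally show ?thesis .
qed

section \<open>Windmills and Zagier's involution\<close>

definition windmills :: "nat \<Rightarrow> (nat \<times> nat \<times> nat \<times> nat) set" where
  "windmills N = {(s, u, y, z). 0 < s \<and> 0 < u \<and> 0 < y \<and> 0 < z \<and> s * s + u * u + 4 * (y * z) = N}"

lemma finite_windmills: "finite (windmills N)"
proof (rule finite_subset)
  show "windmills N \<subseteq> {..N} \<times> {..N} \<times> {..N} \<times> {..N}"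
  proof (clarsimp simp: windmills_def, intro conjI)
    fix s u y z :: nat
    assume pos: "0 < s" "0 < u" "0 < y" "0 < z"
    let ?N = "s * s + u * u + 4 * (y * z)"
    show "s \<le> ?N" using factor_le_of_add_eq[of s s "u * u + 4 * (y * z)" ?N] pos by auto
    show "u \<le> ?N" using factor_le_of_add_eq[of u u "s * s + 4 * (y * z)" ?N] pos by auto
    show "y \<le> ?N" "z \<le> ?N"
      using factor_le_of_add_eq[of y z "s * s + u * u + 3 * (y * z)" ?N] pos by auto
  qed
qed simp

lemma even_card_windmills_swap:
  "even (card (windmills N)) \<longleftrightarrow>
   even (card {(s, y). 0 < s \<and> 0 < y \<and> 2 * (s * s) + 4 * (y * y) = N})"
proof -
  let ?f = "\<lambda>(s, u, y, z). (s, u, z, y)" and ?g = "\<lambda>(s, u, y, z). (u, s, y, z)"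
  let ?V = "{p \<in> windmills N. ?f p = p}"
  have "even (card (windmills N)) \<longleftrightarrow> even (card ?V)"
    by (rule even_card_involution[OF finite_windmills]) (clarsimp simp: windmills_def)+
  also have "\<dots> \<longleftrightarrow> even (card {(s, y). 0 < s \<and> 0 < y \<and> 2 * (s * s) + 4 * (y * y) = N})"
  proof (rule even_card_involution_bij[where f = ?g and g = "\<lambda>(s, y). (s, s, y, y)"
        and h = "\<lambda>(s, u, y, z). (s, y)"])
    show "finite ?V" by (rule finite_subset[OF _ finite_windmills]) auto
  qed (clarsimp simp: windmills_def)+
  finally show ?thesis .
qed

text \<open>The map of Zagier's one-sentence proof of the two-squares theorem, acting on
  \<open>u\<close>, \<open>y\<close>, \<open>z\<close> with \<open>s\<close> as a parameter. The
  guards keep every truncated subtraction exact.\<close>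

definition zagier :: "nat \<times> nat \<times> nat \<times> nat \<Rightarrow> nat \<times> nat \<times> nat \<times> nat" where
  "zagier = (\<lambda>(s, u, y, z).
     if u + z < y then (s, u + 2 * z, z, y - u - z)
     else if u < 2 * y then (s, 2 * y - u, y, u + z - y)
     else (s, u - 2 * y, u + z - y, y))"

text \<open>The hypotheses exclude the two boundaries of the case distinction: where
  \<open>u + z = y\<close> one has \<open>N = s\<^sup>2 + (y + z)\<^sup>2\<close>, and where \<open>u = 2 * y\<close> the number \<open>u\<close> is even.\<close>

lemma even_card_windmills_zagier:
  assumes N: "N mod 4 = 2" and no: "\<And>s u. 0 < s \<Longrightarrow> 0 < u \<Longrightarrow> s * s + u * u \<noteq> N"
  shows "even (card (windmills N)) \<longleftrightarrow>
   even (card {(s, x, d). 0 < s \<and> 0 < x \<and> 0 < d \<and> s * s + x * (x + 2 * d) = N})"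
proof -
  have sq4: "n * n mod 4 = (if even n then 0 else 1)" for n :: nat
  proof -
    have "n mod 4 = 0 \<or> n mod 4 = 1 \<or> n mod 4 = 2 \<or> n mod 4 = 3" by presburger
    moreover have "even n \<longleftrightarrow> even (n mod 4)" by presburger
    ultimately show ?thesis by (auto simp: mod_mult_eq[of n 4 n, symmetric])
  qed
  \<comment> \<open>Squares are 0 or 1 modulo 4, so \<open>N mod 4 = 2\<close> forces both squares
    to be odd.\<close>
  have odd_u: "odd u" if "s * s + u * u + 4 * k = N" for s u k
  proof -
    have "(s * s mod 4 + u * u mod 4) mod 4 = 2"
      using that N by (metis mod_add_eq mod_mult_self2)
    then show ?thesis using sq4[of s] sq4[of u] by (auto split: if_splits)
  qed
  have not1: "u + z \<noteq> y" if "(s, u, y, z) \<in> windmills N" for s u y z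
  proof
    assume "u + z = y"
    then have "s * s + (y + z) * (y + z) = N"
      using that by (auto simp: windmills_def algebra_simps)
    then show False using no[of s "y + z"] that by (auto simp: windmills_def)
  qed
  have not2: "u \<noteq> 2 * y" if "(s, u, y, z) \<in> windmills N" for s u y z
    using odd_u[of s u "y * z"] that by (auto simp: windmills_def)
  have zag: "zagier p \<in> windmills N \<and> zagier (zagier p) = p" if p: "p \<in> windmills N" for p
  proof -
    obtain s u y z where p_eq: "p = (s, u, y, z)" by (cases p)
    note pm = p[unfolded p_eq]
    have pos: "0 < s" "0 < u" "0 < y" "0 < z" and eq: "s * s + u * u + 4 * (y * z) = N"
      using pm by (auto simp: windmills_def)
    consider "u + z < y" | "y < u + z" "u < 2 * y" | "2 * y < u"
      using not1[OF pm] not2[OF pm] by linarith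
    then show ?thesis
    proof cases
      case 1
      then obtain k where k: "y = u + z + k" "0 < k" by (auto dest: less_imp_add_positive)
      then show ?thesis using pos eq p_eq
        by (auto simp: windmills_def zagier_def algebra_simps)
    next
      case 2
      obtain k where k: "u + z = y + k" "0 < k" using less_imp_add_positive[OF 2(1)] by metis
      obtain v where v: "2 * y = u + v" "0 < v" using less_imp_add_positive[OF 2(2)] by metis
      have zk: "z = y + k - u" "int z = int y + int k - int u" "int v = 2 * int y - int u"
        using k v by linarith+
      have "int (s * s + v * v + 4 * (y * k)) = int (s * s + u * u + 4 * (y * z))"
        by (simp add: zk(2,3) algebra_simps)
      then have "s * s + v * v + 4 * (y * k) = N" using eq by linarith
      moreover have "zagier p = (s, v, y, k)" using 2 k v p_eq by (simp add: zagier_def)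
      moreover have "zagier (s, v, y, k) = p" using 2 k v p_eq pos by (simp add: zagier_def)
      ultimately show ?thesis using pos k v by (simp add: windmills_def)
    next
      case 3
      then obtain k where k: "u = 2 * y + k" "0 < k" by (auto dest: less_imp_add_positive)
      then show ?thesis using pos eq p_eq
        by (auto simp: windmills_def zagier_def algebra_simps)
    qed
  qed
  let ?X = "{(s, x, d). 0 < s \<and> 0 < x \<and> 0 < d \<and> s * s + x * (x + 2 * d) = N}"
  \<comment> \<open>This makes \<open>d div 2\<close> exact in the fixed point
    \<open>(s, x, x, d div 2)\<close>. For odd \<open>d\<close>, both parity cases of
    \<open>s\<close> and \<open>x\<close> would give \<open>4 dvd N\<close>.\<close>
  have even_d: "even d" if "s * s + x * (x + 2 * d) = N" for s x d
  proof (rule ccontr)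
    assume "odd d"
    then obtain k where k: "d = 2 * k + 1" by (rule oddE)
    have "even N" using N by presburger
    then have same: "even s \<longleftrightarrow> even x" using that[symmetric] by simp
    have "4 dvd N"
    proof (cases "even x")
      case True
      with same obtain i j where "s = 2 * i" "x = 2 * j" by (auto elim!: evenE)
      then have "N = 4 * (i * i + j * j + j * d)" using that by (simp add: algebra_simps)
      then show ?thesis by simp
    next
      case False
      with same obtain i j where "s = 2 * i + 1" "x = 2 * j + 1" by (auto elim!: oddE)
      then have "N = 4 * (i * i + i + j * j + 2 * j + 2 * (j * k) + k + 1)"
        using that k by (simp add: algebra_simps)
      then show ?thesis by simp
    qed
    then show False using N by presburger
  qed
  \<comment> \<open>The outer branches change \<open>u\<close> by \<open>2 * z\<close> or
    \<open>2 * y\<close>; only the middle one, where \<open>u = 2 * y - u\<close>, can fix a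
    point.\<close>
  have fix_eq: "u = y" if "zagier (s, u, y, z) = (s, u, y, z)" "0 < z" "0 < y" for s u y z
    using that by (auto simp: zagier_def split: if_splits)
  show ?thesis
  proof (rule even_card_involution_bij[where f = zagier and g = "\<lambda>(s, x, d). (s, x, x, d div 2)"
        and h = "\<lambda>(s, u, y, z). (s, u, 2 * z)"])
    show "finite (windmills N)" by (rule finite_windmills)
    show "zagier p \<in> windmills N \<and> zagier (zagier p) = p" if "p \<in> windmills N" for p
      using that by (rule zag)
    let ?g = "\<lambda>(s, x, d). (s, x, x, d div 2)" and ?h = "\<lambda>(s, u, y, z). (s, u, 2 * z)"
    show "?g q \<in> windmills N \<and> zagier (?g q) = ?g q \<and> ?h (?g q) = q" if "q \<in> ?X" for q
    proof -
      obtain s x d where q: "q = (s, x, d)" by (cases q)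
      have pos: "0 < s" "0 < x" "0 < d" and eq: "s * s + x * (x + 2 * d) = N"
        using that unfolding q by simp_all
      obtain e where e: "d = 2 * e" using even_d[OF eq] by (rule evenE)
      have "s * s + x * x + 4 * (x * e) = N" using eq e by (simp add: algebra_simps)
      then show ?thesis using pos e unfolding q by (simp add: windmills_def zagier_def)
    qed
    show "?h p \<in> ?X \<and> ?g (?h p) = p" if "p \<in> windmills N" "zagier p = p" for p
    proof -
      obtain s u y z where p: "p = (s, u, y, z)" by (cases p)
      have pos: "0 < s" "0 < u" "0 < y" "0 < z" and eq: "s * s + u * u + 4 * (y * z) = N"
        using that(1) unfolding p windmills_def by simp_all
      have y: "u = y" using fix_eq that(2) pos unfolding p by blast
      have "s * s + u * (u + 2 * (2 * z)) = N" using eq y by (simp add: algebra_simps)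
      then show ?thesis using pos y unfolding p by simp
    qed
  qed
qed

section \<open>Reduction to a divisor sum\<close>

text \<open>Modulo 2, \<open>marked_pairs N\<close> counts \<open>nu 3 N\<close> plus the
  off-diagonal part of \<open>doubled_pairs N\<close>. Both full sets have the same parity, so only
  the diagonal \<open>x = y\<close> survives.\<close>

lemma even_nu_3_iff:
  assumes N: "N mod 4 = 2" and no: "\<And>s u. 0 < s \<Longrightarrow> 0 < u \<Longrightarrow> s * s + u * u \<noteq> N"
  shows "even (nu 3 N) \<longleftrightarrow> even (card {(x, a, y, b) \<in> doubled_pairs N. x = y})"
proof -
  let ?S = "{(s, t). 0 < s \<and> 0 < t \<and> 2 * (s * s) + t * t = N}"
  let ?R = "{(s, y). 0 < s \<and> 0 < y \<and> 2 * (s * s) + 4 * (y * y) = N}"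
  have even_t: "even t" if "2 * (s * s) + t * t = N" for s t
  proof -
    have "even N" using N by presburger
    then show ?thesis using that by auto
  qed
  \<comment> \<open>As \<open>t\<close> is even, \<open>t = 2 * y\<close> matches what remains of
    the windmills with what remains of \<open>doubled_pairs N\<close>.\<close>
  have "bij_betw (\<lambda>(s, y). (s, 2 * y)) ?R ?S"
  proof (rule bij_betw_imageI)
    show "inj_on (\<lambda>(s, y). (s, 2 * y)) ?R" by (auto simp: inj_on_def)
    show "(\<lambda>(s, y). (s, 2 * y)) ` ?R = ?S"
    proof (intro equalityI subsetI)
      fix p assume "p \<in> ?S"
      then obtain s t where p: "p = (s, t)" "0 < s" "0 < t" "2 * (s * s) + t * t = N" by auto
      then obtain y where y: "t = 2 * y" using even_t[of s t] by (metis evenE)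
      show "p \<in> (\<lambda>(s, y). (s, 2 * y)) ` ?R"
        using p y by (intro image_eqI[of _ _ "(s, y)"]) auto
    qed auto
  qed
  then have "card ?R = card ?S" by (rule bij_betw_same_card)
  then have "even (card (marked_pairs N)) \<longleftrightarrow> even (card (doubled_pairs N))"
    using even_card_marked_pairs_conjugation[of N] even_card_windmills_zagier[OF N no]
      even_card_windmills_swap[of N] even_card_doubled_pairs[of N] by simp
  then show ?thesis
    using card_marked_pairs[of N] card_doubled_pairs[of N]
      even_card_marked_pairs_first[of N] even_card_marked_pairs_second[of N]
    by (auto simp only: even_add even_mult_iff) simp_all
qed

text \<open>On the diagonal \<open>x * (2 * a + b) = N\<close>. The divisor
  \<open>d = 2 * a + b\<close> determines \<open>x\<close>, and \<open>a\<close> ranges over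
  \<open>0 < 2 * a < d\<close>.\<close>

lemma card_doubled_pairs_diagonal:
  assumes "0 < N"
  shows "card {(x, a, y, b) \<in> doubled_pairs N. x = y} = (\<Sum>d | d dvd N. (d - 1) div 2)"
proof -
  let ?D = "{d. d dvd N}" and ?H = "\<lambda>d::nat. {a. 0 < a \<and> 2 * a < d}"
  have H: "?H d = {1..(d - 1) div 2}" for d by auto
  let ?g = "\<lambda>(d, a). (N div d, a, N div d, d - 2 * a)"
  have "bij_betw ?g (Sigma ?D ?H) {(x, a, y, b) \<in> doubled_pairs N. x = y}"
  proof (rule bij_betw_imageI)
    show "inj_on ?g (Sigma ?D ?H)" by (auto simp: inj_on_def)
    show "?g ` Sigma ?D ?H = {(x, a, y, b) \<in> doubled_pairs N. x = y}"
    proof (intro equalityI subsetI)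
      fix p assume "p \<in> ?g ` Sigma ?D ?H"
      then obtain d a where p: "p = (N div d, a, N div d, d - 2 * a)" "d dvd N" "0 < a" "2 * a < d"
        by auto
      then obtain x where x: "N = d * x" by (auto elim: dvdE)
      obtain b where b: "d = 2 * a + b" "0 < b" using less_imp_add_positive[OF p(4)] by metis
      have "N div d = x" "0 < x" using x assms by auto
      then show "p \<in> {(x, a, y, b) \<in> doubled_pairs N. x = y}"
        using p x b by (simp add: doubled_pairs_def algebra_simps)
    next
      fix p assume "p \<in> {(x, a, y, b) \<in> doubled_pairs N. x = y}"
      then obtain x a b where p: "p = (x, a, x, b)" "0 < x" "0 < a" "0 < b"
          and eq: "2 * (x * a) + x * b = N"
        by (auto simp: doubled_pairs_def)
      have N: "N = (2 * a + b) * x" using eq by (simp add: algebra_simps)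
      then have "N div (2 * a + b) = x" using p by (metis add_gr_0 nonzero_mult_div_cancel_left not_gr0)
      then show "p \<in> ?g ` Sigma ?D ?H"
        using p N by (intro image_eqI[of _ _ "(2 * a + b, a)"]) auto
    qed
  qed
  then have "card {(x, a, y, b) \<in> doubled_pairs N. x = y} = card (Sigma ?D ?H)"
    by (simp add: bij_betw_same_card)
  also have "\<dots> = (\<Sum>d\<in>?D. card (?H d))" using assms by (intro card_SigmaI) (auto simp: H)
  finally show ?thesis by (simp add: H)
qed

section \<open>Divisor sums modulo 2\<close>

lemma sum_divisors_prime_mult:
  fixes q m :: nat and f :: "nat \<Rightarrow> nat"
  assumes "prime q" "\<not> q dvd m"
  shows "(\<Sum>d | d dvd q * m. f d) = (\<Sum>d | d dvd m. f d + f (q * d))"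
proof -
  let ?D = "{d. d dvd m}"
  have m: "0 < m" and q: "0 < q" using assms by (auto intro!: gr0I)
  then have fin: "finite ?D" by simp
  have "{d. d dvd q * m} = ?D \<union> (*) q ` ?D"
  proof (intro equalityI subsetI)
    fix d assume "d \<in> {d. d dvd q * m}"
    then have d: "d dvd q * m" by simp
    show "d \<in> ?D \<union> (*) q ` ?D"
    proof (cases "q dvd d")
      case True
      then obtain e where "d = q * e" by (auto elim: dvdE)
      then show ?thesis using d q by simp
    next
      case False
      then have "coprime d q" using assms(1) prime_imp_coprime coprime_commute by blast
      then show ?thesis using d by (simp add: coprime_dvd_mult_right_iff)
    qed
  qed auto
  moreover have "?D \<inter> (*) q ` ?D = {}" using assms(2) by (auto dest: dvd_mult_left)
  ultimately have "(\<Sum>d | d dvd q * m. f d) = sum f ?D + sum f ((*) q ` ?D)"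
    using fin by (simp add: sum.union_disjoint)
  also have "sum f ((*) q ` ?D) = (\<Sum>d\<in>?D. f (q * d))"
    using q by (subst sum.reindex) (auto simp: inj_on_def)
  finally show ?thesis by (simp add: sum.distrib)
qed

text \<open>The pairing of \<open>d\<close> with \<open>m div d\<close> could fix only a square root
  of \<open>m\<close>.\<close>

lemma even_card_divisors_nonsquare:
  fixes m :: nat
  assumes "0 < m" "\<And>k. k * k \<noteq> m"
  shows "even (card {d. d dvd m})"
proof -
  have "even (card {d. d dvd m}) \<longleftrightarrow> even (card {d \<in> {d. d dvd m}. m div d = d})"
    using assms(1) by (intro even_card_involution) (auto elim!: dvdE)
  also have "{d \<in> {d. d dvd m}. m div d = d} = {}"
    using assms(2) dvd_mult_div_cancel by fastforce
  finally show ?thesis by simp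
qed

text \<open>Splitting off 2 and \<open>p\<close> groups the divisors as \<open>d\<close>,
  \<open>2 * d\<close>, \<open>p * d\<close>, \<open>2 * (p * d)\<close> with \<open>d\<close>
  dividing \<open>m\<close>. Each group has an odd sum because \<open>p mod 4 = 3\<close>, and the
  number of groups is even.\<close>

lemma even_sum_divisors:
  fixes p m :: nat
  assumes p: "prime p" "p mod 4 = 3" and m: "odd m" "\<not> p dvd m" "\<And>k. k * k \<noteq> m"
  shows "even (\<Sum>d | d dvd 2 * (p * m). (d - 1) div 2)"
proof -
  let ?f = "\<lambda>d::nat. (d - 1) div 2"
  let ?F = "\<lambda>d. (?f d + ?f (2 * d)) + (?f (p * d) + ?f (2 * (p * d)))"
  have "odd p" using p(2) by presburger
  then have "(\<Sum>d | d dvd 2 * (p * m). ?f d) = (\<Sum>d | d dvd p * m. ?f d + ?f (2 * d))"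
    using m(1) by (intro sum_divisors_prime_mult) auto
  also have "\<dots> = (\<Sum>d | d dvd m. ?F d)"
    using p(1) m(2) by (rule sum_divisors_prime_mult)
  finally have sum_eq: "(\<Sum>d | d dvd 2 * (p * m). ?f d) = (\<Sum>d | d dvd m. ?F d)" .
  have odd_F: "odd (?F d)" if "d dvd m" for d
  proof -
    have "odd d" using m(1) that by (auto elim: dvdE)
    then obtain e where e: "d = 2 * e + 1" by (auto elim: oddE)
    define q where "q = p div 4"
    have q: "p = 4 * q + 3" using p(2) unfolding q_def by presburger
    have pd: "p * d = 2 * (4 * (q * e) + 2 * q + 3 * e + 1) + 1"
      unfolding e q by (simp add: algebra_simps)
    \<comment> \<open>The terms at \<open>2 * d\<close> and \<open>2 * (p * d)\<close> are thus
      even; the other two add up to \<open>e + (4 * (q * e) + 2 * q + 3 * e + 1)\<close>, which is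
      odd.\<close>
    have f: "?f (2 * k + 1) = k" "?f (2 * (2 * k + 1)) = 2 * k" for k by auto
    show ?thesis unfolding pd unfolding e f by simp
  qed
  have "finite {d. d dvd m}" using odd_pos[OF m(1)] by simp
  then have "even (sum ?F {d. d dvd m}) \<longleftrightarrow> even (card {d \<in> {d. d dvd m}. odd (?F d)})"
    by (rule even_sum_iff)
  moreover have "{d \<in> {d. d dvd m}. odd (?F d)} = {d. d dvd m}" using odd_F by blast
  moreover have "even (card {d. d dvd m})"
    using odd_pos[OF m(1)] m(3) by (rule even_card_divisors_nonsquare)
  ultimately show ?thesis unfolding sum_eq by (simp only:)
qed

section \<open>Sums of two squares and primes congruent to 3 modulo 4\<close>

text \<open>Otherwise raising the congruence of \<open>s * s\<close> and \<open>- (u * u)\<close> to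
  the odd power \<open>(p - 1) div 2\<close> gives, by Fermat, 1 congruent to -1 modulo
  \<open>p\<close>.\<close>

lemma prime_3_mod_4_dvd_sum_squares:
  fixes p s u :: nat
  assumes p: "prime p" "p mod 4 = 3" and dvd: "p dvd s * s + u * u"
  shows "p dvd s"
proof (rule ccontr)
  assume s: "\<not> p dvd s"
  then have u: "\<not> p dvd u"
    using dvd p(1) by (metis dvd_add_left_iff dvd_mult prime_dvd_mult_iff)
  define k where "k = (p - 1) div 2"
  have k: "odd k" "p - 1 = 2 * k" using p(2) unfolding k_def by presburger+
  have "[int (s * s) = - int (u * u)] (mod int p)"
    using dvd by (simp add: cong_iff_dvd_diff flip: of_nat_add of_nat_mult)
  then have "[int (s * s) ^ k = (- int (u * u)) ^ k] (mod int p)" by (rule cong_pow)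
  then have "[int (s ^ (p - 1)) = - int (u ^ (p - 1))] (mod int p)"
    using k by (simp add: power_mult power2_eq_square)
  moreover have "[int (s ^ (p - 1)) = int 1] (mod int p)" "[int (u ^ (p - 1)) = int 1] (mod int p)"
    using fermat_theorem[OF p(1) s] fermat_theorem[OF p(1) u] cong_int_iff by blast+
  ultimately have "[1 = - 1] (mod int p)"
    by (metis cong_minus_minus_iff cong_sym cong_trans of_nat_1)
  then have "int p dvd 2" by (simp add: cong_iff_dvd_diff)
  then have "p dvd 2" by presburger
  then show False using p(2) by (auto dest!: dvd_imp_le simp: le_Suc_eq numeral_2_eq_2)
qed

text \<open>\<open>p\<close> would divide \<open>s\<close> and \<open>u\<close>, hence
  \<open>p * p\<close> the sum, but \<open>p\<close> divides \<open>2 * (p * m)\<close> only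
  once.\<close>

lemma not_sum_squares:
  fixes p m s u :: nat
  assumes p: "prime p" "p mod 4 = 3" and m: "\<not> p dvd m"
  shows "s * s + u * u \<noteq> 2 * (p * m)"
proof
  assume eq: "s * s + u * u = 2 * (p * m)"
  then have "p dvd s * s + u * u" "p dvd u * u + s * s" by (simp_all add: add.commute)
  then have "p dvd s" "p dvd u" using prime_3_mod_4_dvd_sum_squares p by blast+
  then have "p * p dvd 2 * (p * m)" unfolding eq[symmetric] by (intro dvd_add mult_dvd_mono)
  then have "p * p dvd p * (2 * m)" by (simp add: ac_simps)
  then have "p dvd 2 * m" using p(1) by (simp add: prime_gt_0_nat)
  then have "p dvd 2" using p(1) m by (simp add: prime_dvd_mult_iff)
  then have "p = 2" using p(1) by (simp add: primes_dvd_imp_eq)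
  then show False using p(2) by simp
qed

lemma even_nu_3:
  fixes p m :: nat
  assumes p: "prime p" "p mod 4 = 3" and m: "odd m" "\<not> p dvd m" "\<And>k. k * k \<noteq> m"
  shows "even (nu 3 (2 * (p * m)))"
proof -
  have "odd p" using p(2) by presburger
  then have "odd (p * m)" using m(1) by simp
  then have "2 * (p * m) mod 4 = 2" and pos: "0 < 2 * (p * m)" by presburger+
  then have "even (nu 3 (2 * (p * m))) \<longleftrightarrow>
      even (card {(x, a, y, b) \<in> doubled_pairs (2 * (p * m)). x = y})"
    using not_sum_squares[OF p m(2)] by (intro even_nu_3_iff)
  then show ?thesis
    unfolding card_doubled_pairs_diagonal[OF pos] using even_sum_divisors[OF p m] by simp
qed

section \<open>Residues that exclude squares, and the four progressions\<close>

lemma square_mod_3_neq_2: "k * k mod 3 \<noteq> (2::nat)"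
proof -
  have "k mod 3 \<in> {0, 1, 2}" by auto
  then show ?thesis by (auto simp: mod_mult_eq[of k 3 k, symmetric])
qed

lemma square_mod_4_neq_3: "k * k mod 4 \<noteq> (3::nat)"
proof -
  have "k mod 4 \<in> {0, 1, 2, 3}" by auto
  then show ?thesis by (auto simp: mod_mult_eq[of k 4 k, symmetric])
qed

lemma square_mod_7_neq_5: "k * k mod 7 \<noteq> (5::nat)"
proof -
  have "k mod 7 \<in> {0, 1, 2, 3, 4, 5, 6}" by auto
  then show ?thesis by (auto simp: mod_mult_eq[of k 7 k, symmetric])
qed

theorem theorem2:
  fixes A B n :: nat
  assumes "(A, B) \<in> {(36, 30), (72, 42), (196, 70), (252, 114)}"
  shows "[nu 3 (A * n + B) = 0] (mod 2)"
proof -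
  \<comment> \<open>The cofactors of \<open>2 * p\<close> are nonsquares by their residues: 2 modulo
    3, 3 modulo 4, and 5 modulo 7 for the last two.\<close>
  consider "A * n + B = 2 * (3 * (6 * n + 5))" | "A * n + B = 2 * (3 * (12 * n + 7))"
    | "A * n + B = 2 * (7 * (14 * n + 5))" | "A * n + B = 2 * (3 * (42 * n + 19))"
    using assms by auto
  then have "even (nu 3 (A * n + B))"
  proof cases
    case 1
    have "even (nu 3 (2 * (3 * (6 * n + 5))))"
    proof (rule even_nu_3)
      have "(6 * n + 5) mod 3 = 2" by presburger
      then show "k * k \<noteq> 6 * n + 5" for k using square_mod_3_neq_2[of k] by metis
      show "\<not> 3 dvd 6 * n + 5" by presburger
    qed simp_all
    then show ?thesis unfolding 1 .
  next
    case 2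
    have "even (nu 3 (2 * (3 * (12 * n + 7))))"
    proof (rule even_nu_3)
      have "(12 * n + 7) mod 4 = 3" by presburger
      then show "k * k \<noteq> 12 * n + 7" for k using square_mod_4_neq_3[of k] by metis
      show "\<not> 3 dvd 12 * n + 7" by presburger
    qed simp_all
    then show ?thesis unfolding 2 .
  next
    case 3
    have "even (nu 3 (2 * (7 * (14 * n + 5))))"
    proof (rule even_nu_3)
      have "(14 * n + 5) mod 7 = 5" by presburger
      then show "k * k \<noteq> 14 * n + 5" for k using square_mod_7_neq_5[of k] by metis
      show "\<not> 7 dvd 14 * n + 5" by presburger
    qed simp_all
    then show ?thesis unfolding 3 .
  next
    case 4
    have "even (nu 3 (2 * (3 * (42 * n + 19))))"
    proof (rule even_nu_3)
      have "(42 * n + 19) mod 7 = 5" by presburger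
      then show "k * k \<noteq> 42 * n + 19" for k using square_mod_7_neq_5[of k] by metis
      show "\<not> 3 dvd 42 * n + 19" by presburger
    qed simp_all
    then show ?thesis unfolding 4 .
  qed
  then show ?thesis by (simp add: cong_0_iff)
qed

end
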